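(* Let $n\ge 1$, let $\varphi:[1,\infty)\times[1,\infty)\to(0,\infty)$ be a function and $c>0$ a constant such that $$\left\| \frac{M_d (fv)}{v} \right\|_{L^{1, \infty}(uv)}\le c \,\varphi([u]_{A_1},[v]_{A_1})\,\|f\|_{L^1(uv)}$$ for all weights $u\in A_1$, $v\in A_1$ on $\mathbb{R}^n$ and all $f\in L^1(uv)$. Then there is a constant $c'>0$, independent of the weights, such that $$\varphi([u]_{A_1},[v]_{A_1})\ge c'\,[u]_{A_1}[v]_{A_1}$$ for all $u\in A_1$, $v\in A_1$.
   Context: A weight is a nonnegative locally integrable function on $\mathbb{R}^n$. Cubes have sides parallel to the coordinate axes. For a weight $w$, $[w]_{A_1}=\sup_Q\left(\frac1{|Q|}\int_Q w\right)(\operatorname{ess\,inf}_Q w)^{-1}$, the supremum over all cubes $Q\subset\mathbb{R}^n$, and $w\in A_1$ means $[w]_{A_1}<\infty$. $M_d$ is the dyadic maximal operator, $M_d h(x)=\sup_{Q\ni x}\frac1{|Q|}\int_Q|h|$, the supremum over all dyadic cubes $Q$ containing $x$. For a weight $w$, $\|f\|_{L^1(w)}=\int_{\mathbb{R}^n}|f|\,w\,dx$ and $\|F\|_{L^{1,\infty}(w)}=\sup_{t>0} t\, w(\{x:|F(x)|>t\})$, where $w(E)=\int_E w\,dx$. *)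

theory Defs
  imports "HOL-Analysis.Analysis"
begin

definition weight :: "(real^'n \<Rightarrow> real) \<Rightarrow> bool" where
  "weight w \<longleftrightarrow> w \<in> borel_measurable lebesgue \<and> (\<forall>x. 0 \<le> w x) \<and>
     (\<forall>K. compact K \<longrightarrow> set_integrable lebesgue K w)"

definition cubes :: "(real^'n) set set" where
  "cubes = {cbox a (\<chi> i. a $ i + l) | a l. 0 < l}"

definition dyadic_cubes :: "(real^'n) set set" where
  "dyadic_cubes =
     {{x. \<forall>i. 2 powi k * real_of_int (m i) \<le> x $ i \<and> x $ i < 2 powi k * (real_of_int (m i) + 1)}
       | (k :: int) (m :: 'n \<Rightarrow> int). True}"

definition average :: "(real^'n) set \<Rightarrow> (real^'n \<Rightarrow> real) \<Rightarrow> ennreal" where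
  "average Q h = (\<integral>\<^sup>+x\<in>Q. ennreal \<bar>h x\<bar> \<partial>lebesgue) / emeasure lebesgue Q"

definition ess_inf_on :: "(real^'n) set \<Rightarrow> (real^'n \<Rightarrow> real) \<Rightarrow> ennreal" where
  "ess_inf_on Q w = Sup {c. AE x in lebesgue. x \<in> Q \<longrightarrow> c \<le> ennreal (w x)}"

definition A1_const :: "(real^'n \<Rightarrow> real) \<Rightarrow> ennreal" where
  "A1_const w = (SUP Q\<in>cubes. average Q w * inverse (ess_inf_on Q w))"

(* In ennreal, 0 * inverse 0 = 0, so the weight that vanishes almost everywhere would have
   constant 0.  It is excluded here; every other weight has constant at least 1. *)
definition A1 :: "(real^'n \<Rightarrow> real) set" where
  "A1 = {w. weight w \<and> \<not> (AE x in lebesgue. w x = 0) \<and> A1_const w < \<infinity>}"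

definition dyadic_maximal :: "(real^'n \<Rightarrow> real) \<Rightarrow> real^'n \<Rightarrow> ennreal" where
  "dyadic_maximal h x = (SUP Q\<in>{Q \<in> dyadic_cubes. x \<in> Q}. average Q h)"

definition L1_norm :: "(real^'n \<Rightarrow> real) \<Rightarrow> (real^'n \<Rightarrow> real) \<Rightarrow> ennreal" where
  "L1_norm w f = (\<integral>\<^sup>+x. ennreal (\<bar>f x\<bar> * w x) \<partial>lebesgue)"

definition L1 :: "(real^'n \<Rightarrow> real) \<Rightarrow> (real^'n \<Rightarrow> real) set" where
  "L1 w = {f. f \<in> borel_measurable lebesgue \<and> L1_norm w f < \<infinity>}"

definition wmeasure :: "(real^'n \<Rightarrow> real) \<Rightarrow> (real^'n) set \<Rightarrow> ennreal" where
  "wmeasure w E = (\<integral>\<^sup>+x\<in>E. ennreal (w x) \<partial>lebesgue)"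

(* F plays the role of an absolute value, so it takes values in [0, \<infinity>]. *)
definition weak_L1_norm :: "(real^'n \<Rightarrow> real) \<Rightarrow> (real^'n \<Rightarrow> ennreal) \<Rightarrow> ennreal" where
  "weak_L1_norm w F = (SUP t\<in>{0 :: real<..}. ennreal t * wmeasure w {x. ennreal t < F x})"

end

(*
  Extremal weights. Put N for the dimension and Q0 = [0,d)^N for a small dyadic d. The weight u equal
  to 1 on Q0 and to s elsewhere has A1 constant exactly s. The weight v is a truncation of
  min(1, |x|^(-N)), namely the sum of 2^(-kN) over the cubes |x| < 2^k, k < J, and over the whole
  space for k = J, raised by the factor t on Q0. The truncated power has A1 constant O(J), and for
  d small the factor t on Q0 is what determines the constant of v, so that it equals t as soon as
  J is at most a small multiple of t. For f v = 1_Q0 the quotient M_d(f v)/v exceeds d^N/4 on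
  [0,2^J)^N - Q0, where u = s and each of the J + 1 scales contributes at least 1/2 to the integral
  of v. The weak norm is thus at least a multiple of s (J + 1) d^N, and J + 1 can be taken of order t,
  while the norm of f in L^1(uv) is d^N because u = 1 on Q0.
*)
theory Submission
  imports Defs
begin

section \<open>Volumes of cubes and of corners at the origin\<close>

lemma cube_lmeasurable: "cbox (a::real^'n) (\<chi> i. a $ i + l) \<in> lmeasurable"
  by simp

lemma measure_cube:
  assumes "0 \<le> l"
  shows "measure lebesgue (cbox (a::real^'n) (\<chi> i. a $ i + l)) = l ^ CARD('n)"
proof -
  have "measure lebesgue (cbox a (\<chi> i. a $ i + l)) = measure lborel (cbox a (\<chi> i. a $ i + l))"
    by simp
  also have "\<dots> = l ^ CARD('n)"
    using assms by (subst content_cbox_cart) (auto simp: interval_ne_empty_cart)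
  finally show ?thesis .
qed

text \<open>Half-open, so that \<open>corner (2 ^ j)\<close> is itself a dyadic cube.\<close>

definition corner :: "real \<Rightarrow> (real^'n) set" where
  "corner r = {x. \<forall>i. 0 \<le> x $ i \<and> x $ i < r}"

lemma corner_lmeasurable: "(corner r :: (real^'n) set) \<in> lmeasurable"
proof (rule bounded_set_imp_lmeasurable)
  have "corner r \<subseteq> cbox 0 (\<chi> i. r :: real^'n)"
    by (auto simp: corner_def mem_box_cart less_imp_le)
  then show "bounded (corner r :: (real^'n) set)"
    using bounded_cbox bounded_subset by blast
  have "(corner r :: (real^'n) set) \<in> sets borel"
    unfolding corner_def by measurable
  then show "(corner r :: (real^'n) set) \<in> sets lebesgue"
    by simp
qed

lemma measure_corner:
  assumes "0 \<le> r"
  shows "measure lebesgue (corner r :: (real^'n) set) = r ^ CARD('n)"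
proof (rule antisym)
  have c: "measure lebesgue (cbox (0::real^'n) (\<chi> i. r)) = r ^ CARD('n)"
    using measure_cube[OF assms, of "0::real^'n"] by simp
  have "measure lebesgue (corner r :: (real^'n) set) \<le> measure lebesgue (cbox (0::real^'n) (\<chi> i. r))"
    by (rule measure_mono_fmeasurable)
       (auto simp: corner_def mem_box_cart less_imp_le corner_lmeasurable[THEN fmeasurableD, unfolded corner_def])
  then show "measure lebesgue (corner r :: (real^'n) set) \<le> r ^ CARD('n)" using c by simp
  have "measure lebesgue (box (0::real^'n) (\<chi> i. r)) \<le> measure lebesgue (corner r :: (real^'n) set)"
    by (rule measure_mono_fmeasurable[OF _ _ corner_lmeasurable])
       (auto simp: corner_def mem_box_cart less_imp_le)
  moreover have "measure lebesgue (box (0::real^'n) (\<chi> i. r)) = measure lebesgue (cbox (0::real^'n) (\<chi> i. r))"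
    by (simp add: measure_lborel_box_eq measure_lborel_cbox_eq)
  ultimately show "r ^ CARD('n) \<le> measure lebesgue (corner r :: (real^'n) set)" using c by simp
qed

text \<open>The sets \<open>S k\<close> are only measurable and may have infinite volume, as the
  last layer of the weight below does; finiteness comes from intersecting with
  \<open>Q\<close>.\<close>

lemma set_nn_integral_indicator_sum:
  fixes c :: "'k \<Rightarrow> real" and S :: "'k \<Rightarrow> (real^'n) set"
  assumes "finite K" "Q \<in> lmeasurable" "\<And>k. k \<in> K \<Longrightarrow> S k \<in> sets lebesgue" "\<And>k. k \<in> K \<Longrightarrow> 0 \<le> c k"
  shows "(\<integral>\<^sup>+x\<in>Q. ennreal (\<Sum>k\<in>K. c k * indicator (S k) x) \<partial>lebesgue)
    = ennreal (\<Sum>k\<in>K. c k * measure lebesgue (S k \<inter> Q))"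
proof -
  have fin: "S k \<inter> Q \<in> lmeasurable" if "k \<in> K" for k
    using assms that by (simp add: fmeasurable_Int_fmeasurable inf_commute)
  have "(\<integral>\<^sup>+x\<in>Q. ennreal (\<Sum>k\<in>K. c k * indicator (S k) x) \<partial>lebesgue)
    = (\<integral>\<^sup>+x. (\<Sum>k\<in>K. ennreal (c k) * indicator (S k \<inter> Q) x) \<partial>lebesgue)"
  proof (rule nn_integral_cong)
    fix x :: "real^'n"
    have "ennreal (\<Sum>k\<in>K. c k * indicator (S k) x) = (\<Sum>k\<in>K. ennreal (c k * indicator (S k) x))"
      by (rule sum_ennreal[symmetric]) (use assms in auto)
    then show "ennreal (\<Sum>k\<in>K. c k * indicator (S k) x) * indicator Q x
      = (\<Sum>k\<in>K. ennreal (c k) * indicator (S k \<inter> Q) x)"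
      by (auto simp: indicator_def intro!: sum.cong)
  qed
  also have "\<dots> = (\<Sum>k\<in>K. ennreal (c k) * emeasure lebesgue (S k \<inter> Q))"
    using fin by (subst nn_integral_sum) (auto simp: nn_integral_cmult_indicator fmeasurableD)
  also have "\<dots> = (\<Sum>k\<in>K. ennreal (c k * measure lebesgue (S k \<inter> Q)))"
    using fin assms by (intro sum.cong) (auto simp: emeasure_eq_measure2 ennreal_mult)
  also have "\<dots> = ennreal (\<Sum>k\<in>K. c k * measure lebesgue (S k \<inter> Q))"
    using assms by (intro sum_ennreal) auto
  finally show ?thesis .
qed

lemma emeasure_cube:
  assumes "0 \<le> l"
  shows "emeasure lebesgue (cbox (a::real^'n) (\<chi> i. a $ i + l)) = ennreal (l ^ CARD('n))"
  using measure_cube[OF assms, of a] emeasure_eq_measure2[OF cube_lmeasurable[of a l]] by simp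

section \<open>Upper and lower bounds for the A1 constant\<close>

lemma ennreal_inverse_antimono:
  fixes x y :: ennreal
  assumes "x \<le> y"
  shows "inverse y \<le> inverse x"
  using assms
  by (cases x rule: ennreal_cases; cases y rule: ennreal_cases; cases "x = 0"; cases "y = 0")
    (auto simp: inverse_ennreal top_unique intro!: ennreal_leI le_imp_inverse_le)

text \<open>A pointwise lower bound \<open>m\<close> on the cube lies below the essential infimum,
  so it is enough to compare the integral with \<open>m\<close> times the volume. The number
  \<open>m\<close> may depend on the cube.\<close>

lemma A1_const_le:
  fixes w :: "real^'n \<Rightarrow> real"
  assumes "0 \<le> K" "\<And>x. 0 \<le> w x"
    and cube: "\<And>a l. 0 < l \<Longrightarrow> \<exists>m>0. (\<forall>x\<in>cbox a (\<chi> i. a $ i + l). m \<le> w x) \<and>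
      (\<integral>\<^sup>+x\<in>cbox a (\<chi> i. a $ i + l). ennreal (w x) \<partial>lebesgue) \<le> ennreal (K * m * l ^ CARD('n))"
  shows "A1_const w \<le> ennreal K"
  unfolding A1_const_def
proof (rule SUP_least)
  fix Q :: "(real^'n) set" assume "Q \<in> cubes"
  then obtain a l where Q: "Q = cbox a (\<chi> i. a $ i + l)" and l: "0 < l"
    unfolding cubes_def by blast
  obtain m where m: "0 < m" "\<forall>x\<in>Q. m \<le> w x"
    and int: "(\<integral>\<^sup>+x\<in>Q. ennreal (w x) \<partial>lebesgue) \<le> ennreal (K * m * l ^ CARD('n))"
    using cube[OF l, of a] unfolding Q by blast
  have "ennreal m \<le> ess_inf_on Q w"
    unfolding ess_inf_on_def using m by (intro Sup_upper) (auto intro!: ennreal_leI)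
  then have "inverse (ess_inf_on Q w) \<le> inverse (ennreal m)"
    by (simp add: ennreal_inverse_antimono)
  also have "\<dots> = ennreal (inverse m)"
    using m by (simp add: inverse_ennreal)
  finally have i: "inverse (ess_inf_on Q w) \<le> ennreal (inverse m)" .
  have "average Q w \<le> ennreal (K * m * l ^ CARD('n)) / ennreal (l ^ CARD('n))"
    using int assms(2) unfolding average_def Q emeasure_cube[OF less_imp_le[OF l]]
    by (simp add: divide_right_mono_ennreal)
  also have "\<dots> = ennreal (K * m)"
    using l m assms by (simp add: divide_ennreal)
  finally have "average Q w \<le> ennreal (K * m)" .
  then have "average Q w * inverse (ess_inf_on Q w) \<le> ennreal (K * m) * ennreal (inverse m)"
    using i by (intro mult_mono) auto
  also have "\<dots> = ennreal K"
    using m assms by (subst ennreal_mult[symmetric]) auto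
  finally show "average Q w * inverse (ess_inf_on Q w) \<le> ennreal K" .
qed

text \<open>A single cube is tested: \<open>A\<close> makes its average large, while
  \<open>B\<close>, having positive measure, keeps its essential infimum at most
  \<open>h\<close>.\<close>

lemma A1_const_ge:
  fixes w :: "real^'n \<Rightarrow> real"
  assumes "0 < l" "0 \<le> H" "0 < h" "A \<in> lmeasurable" "B \<in> lmeasurable" "0 < measure lebesgue B"
    and "A \<subseteq> cbox a (\<chi> i. a $ i + l)" "\<And>x. x \<in> A \<Longrightarrow> H \<le> w x"
    and "B \<subseteq> cbox a (\<chi> i. a $ i + l)" "\<And>x. x \<in> B \<Longrightarrow> w x \<le> h"
  shows "ennreal (H * measure lebesgue A / l ^ CARD('n) / h) \<le> A1_const w"
proof -
  define Q where "Q = cbox a (\<chi> i. a $ i + l)"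
  have "c \<le> ennreal h" if c: "AE x in lebesgue. x \<in> Q \<longrightarrow> c \<le> ennreal (w x)" for c
  proof (rule ccontr)
    assume "\<not> c \<le> ennreal h"
    have "AE x in lebesgue. x \<notin> B"
      using c
    proof eventually_elim
      case (elim x)
      then show ?case
        using assms(9) assms(10)[of x] \<open>\<not> c \<le> ennreal h\<close> unfolding Q_def
        by (meson ennreal_leI order_trans subsetD)
    qed
    then have "emeasure lebesgue B = 0"
      using assms(5) by (subst (asm) AE_iff_measurable[OF _ refl]) (auto simp: fmeasurableD)
    then show False using assms(6) by (simp add: measure_def)
  qed
  then have "ess_inf_on Q w \<le> ennreal h"
    unfolding ess_inf_on_def by (auto intro: Sup_least)
  then have i: "ennreal (inverse h) \<le> inverse (ess_inf_on Q w)"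
    using ennreal_inverse_antimono[of "ess_inf_on Q w" "ennreal h"] assms by (simp add: inverse_ennreal)
  have "ennreal (H * measure lebesgue A) = (\<integral>\<^sup>+x. ennreal H * indicator A x \<partial>lebesgue)"
    using assms by (simp add: nn_integral_cmult_indicator fmeasurableD emeasure_eq_measure2 ennreal_mult)
  also have "\<dots> \<le> (\<integral>\<^sup>+x\<in>Q. ennreal \<bar>w x\<bar> \<partial>lebesgue)"
    using assms(7,8)
    by (intro nn_integral_mono) (auto simp: Q_def indicator_def intro!: ennreal_leI dest: order_trans[OF _ abs_ge_self])
  finally have "ennreal (H * measure lebesgue A) / ennreal (l ^ CARD('n)) \<le> average Q w"
    unfolding average_def Q_def emeasure_cube[OF less_imp_le[OF assms(1)]]
    by (rule divide_right_mono_ennreal)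
  then have "ennreal (H * measure lebesgue A / l ^ CARD('n)) \<le> average Q w"
    using assms(1,2) by (simp add: divide_ennreal)
  then have "ennreal (H * measure lebesgue A / l ^ CARD('n)) * ennreal (inverse h)
      \<le> average Q w * inverse (ess_inf_on Q w)"
    using i by (intro mult_mono) auto
  also have "\<dots> \<le> A1_const w"
    unfolding A1_const_def using assms(1) by (intro SUP_upper) (auto simp: Q_def cubes_def)
  finally show ?thesis
    using assms(1-3) by (subst (asm) ennreal_mult[symmetric]) (auto simp: field_simps)
qed

text \<open>The upper bound gives local integrability, and the positive lower bound excludes the
  weight that vanishes almost everywhere.\<close>

lemma A1I:
  fixes w :: "real^'n \<Rightarrow> real"
  assumes w: "w \<in> borel_measurable lebesgue" and "0 < m" "\<And>x. m \<le> w x" "\<And>x. w x \<le> M" "A1_const w < \<infinity>"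
  shows "w \<in> A1"
proof -
  have "set_integrable lebesgue K w" if "compact K" for K
  proof -
    have K: "K \<in> lmeasurable" using that by (rule lmeasurable_compact)
    show ?thesis
      unfolding set_integrable_def
    proof (rule Bochner_Integration.integrable_bound)
      show "integrable lebesgue (\<lambda>x. M * indicator K x)"
        using K by (intro integrable_mult_right integrable_real_indicator) (auto simp: fmeasurable_def)
      show "(\<lambda>x. indicator K x *\<^sub>R w x) \<in> borel_measurable lebesgue"
        using w K by (intro borel_measurable_scaleR borel_measurable_indicator) (auto simp: fmeasurableD)
      show "AE x in lebesgue. norm (indicator K x *\<^sub>R w x) \<le> norm (M * indicator K x)"
      proof (intro always_eventually allI)
        fix x
        have "0 \<le> w x" "w x \<le> M" "0 \<le> M"
          using assms(2) assms(3)[of x] assms(4)[of x] by linarith+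
        then show "norm (indicator K x *\<^sub>R w x) \<le> norm (M * indicator K x)"
          by (simp add: indicator_def)
      qed
    qed
  qed
  moreover have "\<not> (AE x in lebesgue. w x = 0)"
  proof
    assume "AE x in lebesgue. w x = 0"
    then have "AE x::real^'n in lebesgue. False"
      by eventually_elim (use assms(2,3) in \<open>metis not_less\<close>)
    then show False
      by (subst (asm) AE_iff_measurable[where N = UNIV]) auto
  qed
  ultimately show ?thesis
    unfolding A1_def weight_def using w \<open>A1_const w < \<infinity>\<close> order_trans[OF less_imp_le[OF assms(2)] assms(3)]
    by blast
qed

text \<open>An average dominates the essential infimum on the same cube. The work lies in finding a
  cube on which the product is not degenerate; the result puts the constants of arbitrary weights
  into the domain of the function in the theorem.\<close>

lemma A1_const_ge_1:
  fixes w :: "real^'n \<Rightarrow> real"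
  assumes "w \<in> A1"
  shows "1 \<le> A1_const w"
proof -
  have w: "w \<in> borel_measurable lebesgue" "\<And>x. 0 \<le> w x" "\<not> (AE x in lebesgue. w x = 0)"
    and int: "\<And>K. compact K \<Longrightarrow> set_integrable lebesgue K w"
    using assms by (auto simp: A1_def weight_def)
  have "\<exists>Q\<in>cubes. average Q w \<noteq> 0"
  proof (rule ccontr)
    assume 0: "\<not> ?thesis"
    \<comment> \<open>If all averages vanish, then so does \<open>w\<close> almost everywhere on
      each of countably many centred cubes that exhaust the space.\<close>
    have "AE x in lebesgue. x \<in> cbox (\<chi> i. - real (Suc k)) (\<chi> i. real (Suc k)) \<longrightarrow> w x = 0" for k
    proof -
      define Q :: "(real^'n) set" where "Q = cbox (\<chi> i. - real (Suc k)) (\<chi> i. real (Suc k))"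
      have Q: "Q = cbox (\<chi> i. - real (Suc k)) (\<chi> i. (\<chi> i. - real (Suc k)) $ i + 2 * real (Suc k))"
        unfolding Q_def by simp
      have "Q \<in> cubes"
        unfolding cubes_def by (subst Q) (fastforce simp del: of_nat_Suc)
      then have "average Q w = 0" using 0 by blast
      moreover have "emeasure lebesgue Q \<noteq> top"
        unfolding Q_def using lmeasurable_cbox by (metis fmeasurableD2)
      ultimately have "(\<integral>\<^sup>+x\<in>Q. ennreal \<bar>w x\<bar> \<partial>lebesgue) = 0"
        by (simp add: average_def ennreal_divide_eq_0_iff)
      then have "AE x in lebesgue. ennreal \<bar>w x\<bar> * indicator Q x = 0"
      proof (subst (asm) nn_integral_0_iff_AE)
        show "(\<lambda>x. ennreal \<bar>w x\<bar> * indicator Q x) \<in> borel_measurable lebesgue"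
          using w(1) by (intro borel_measurable_times_ennreal borel_measurable_indicator) (auto simp: Q_def)
      qed
      then show ?thesis
        unfolding Q_def by eventually_elim (auto simp: indicator_def)
    qed
    then have "AE x in lebesgue. \<forall>k. x \<in> cbox (\<chi> i. - real (Suc k)) (\<chi> i. real (Suc k)) \<longrightarrow> w x = 0"
      by (subst AE_all_countable) auto
    then have "AE x in lebesgue. w x = 0"
    proof eventually_elim
      case (elim x)
      obtain k where "norm x \<le> real k" using real_arch_simple by blast
      then have "\<bar>x $ i\<bar> \<le> real (Suc k)" for i
        using component_le_norm_cart[of x i] by linarith
      then have "x \<in> cbox (\<chi> i. - real (Suc k)) (\<chi> i. real (Suc k))"
        by (simp add: mem_box_cart abs_le_iff minus_le_iff del: of_nat_Suc)
      then show ?case using elim by blast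
    qed
    then show False using w(3) by blast
  qed
  then obtain a l where l: "0 < l" and nz: "average (cbox a (\<chi> i. a $ i + l)) w \<noteq> 0"
    unfolding cubes_def by blast
  define Q where "Q = cbox a (\<chi> i. a $ i + l)"
  have vol: "emeasure lebesgue Q = ennreal (l ^ CARD('n))"
    using l unfolding Q_def by (intro emeasure_cube) simp
  have "(\<integral>\<^sup>+x\<in>Q. ennreal \<bar>w x\<bar> \<partial>lebesgue) < \<infinity>"
  proof -
    have "integrable lebesgue (\<lambda>x. indicator Q x *\<^sub>R w x)"
      using int[of Q] by (simp add: Q_def set_integrable_def)
    then have "(\<integral>\<^sup>+x. ennreal (norm (indicator Q x *\<^sub>R w x)) \<partial>lebesgue) < \<infinity>"
      by (simp add: integrable_iff_bounded)
    also have "(\<lambda>x. ennreal (norm (indicator Q x *\<^sub>R w x))) = (\<lambda>x. ennreal \<bar>w x\<bar> * indicator Q x)"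
      by (auto simp: indicator_def)
    finally show ?thesis .
  qed
  then have fin: "average Q w < \<infinity>"
    unfolding average_def vol using l by (simp add: divide_ennreal_def inverse_ennreal ennreal_mult_less_top)
  have "ess_inf_on Q w \<le> average Q w"
    unfolding ess_inf_on_def
  proof (rule Sup_least, clarify)
    fix c assume c: "AE x in lebesgue. x \<in> Q \<longrightarrow> c \<le> ennreal (w x)"
    have "c * ennreal (l ^ CARD('n)) = (\<integral>\<^sup>+x. c * indicator Q x \<partial>lebesgue)"
      using vol by (subst nn_integral_cmult_indicator) (auto simp: Q_def)
    also have "\<dots> \<le> (\<integral>\<^sup>+x\<in>Q. ennreal \<bar>w x\<bar> \<partial>lebesgue)"
      using c by (intro nn_integral_mono_AE, eventually_elim) (use w(2) in \<open>auto simp: indicator_def\<close>)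
    finally have "c * ennreal (l ^ CARD('n)) / ennreal (l ^ CARD('n)) \<le> average Q w"
      unfolding average_def vol by (rule divide_right_mono_ennreal)
    then show "c \<le> average Q w"
      using l by (simp add: ennreal_mult_divide_eq)
  qed
  \<comment> \<open>In \<open>ennreal\<close>, \<open>x * inverse x = 1\<close> fails at 0 and at
    infinity. At 0 the product is infinite by \<open>nz\<close>; infinity is ruled out by
    \<open>fin\<close>.\<close>
  then have "1 \<le> average Q w * inverse (ess_inf_on Q w)"
  proof (cases "ess_inf_on Q w = 0")
    case True
    then show ?thesis using nz by (simp add: Q_def ennreal_mult_top)
  next
    case False
    then have "1 = ess_inf_on Q w * inverse (ess_inf_on Q w)"
      using fin \<open>ess_inf_on Q w \<le> average Q w\<close>
      by (subst divide_ennreal_def[symmetric], subst ennreal_divide_self) auto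
    also have "\<dots> \<le> average Q w * inverse (ess_inf_on Q w)"
      by (rule mult_right_mono) (use \<open>ess_inf_on Q w \<le> average Q w\<close> in auto)
    finally show ?thesis .
  qed
  also have "\<dots> \<le> A1_const w"
    unfolding A1_const_def using l by (intro SUP_upper) (auto simp: Q_def cubes_def)
  finally show ?thesis .
qed

lemma set_nn_integral_cube_le:
  fixes w :: "real^'n \<Rightarrow> real"
  assumes "0 < l" "0 \<le> M" "\<And>x. x \<in> cbox a (\<chi> i. a $ i + l) \<Longrightarrow> w x \<le> M"
  shows "(\<integral>\<^sup>+x\<in>cbox a (\<chi> i. a $ i + l). ennreal (w x) \<partial>lebesgue) \<le> ennreal (M * l ^ CARD('n))"
proof -
  define Q where "Q = cbox a (\<chi> i. a $ i + l)"
  have vol: "emeasure lebesgue Q = ennreal (l ^ CARD('n))"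
    using assms(1) unfolding Q_def by (intro emeasure_cube) simp
  have "(\<integral>\<^sup>+x\<in>Q. ennreal (w x) \<partial>lebesgue) \<le> (\<integral>\<^sup>+x. ennreal M * indicator Q x \<partial>lebesgue)"
    using assms(3) by (intro nn_integral_mono) (auto simp: Q_def indicator_def intro!: ennreal_leI)
  also have "\<dots> = ennreal M * emeasure lebesgue Q"
    by (rule nn_integral_cmult_indicator) (simp add: Q_def)
  also have "\<dots> = ennreal (M * l ^ CARD('n))"
    unfolding vol using assms by (simp add: ennreal_mult)
  finally show ?thesis unfolding Q_def .
qed

section \<open>The weight that is 1 on a corner and \<open>s\<close> elsewhere\<close>

lemma corner_mono: "r \<le> r' \<Longrightarrow> corner r \<subseteq> corner r'"
  by (auto simp: corner_def intro: less_le_trans)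

lemma measure_corner_diff:
  assumes "0 \<le> r" "r \<le> r'"
  shows "measure lebesgue (corner r' - corner r :: (real^'n) set) = r' ^ CARD('n) - r ^ CARD('n)"
  using assms corner_mono[OF assms(2), where 'a = 'n]
  by (subst measurable_measure_Diff) (auto simp: corner_lmeasurable fmeasurableD measure_corner)

definition low_corner :: "real \<Rightarrow> real \<Rightarrow> real^'n \<Rightarrow> real" where
  "low_corner d s x = (if x \<in> corner d then 1 else s)"

lemma low_corner_measurable: "(low_corner d s :: real^'n \<Rightarrow> real) \<in> borel_measurable lebesgue"
  unfolding low_corner_def using fmeasurableD[OF corner_lmeasurable, of d]
  by (intro measurable_If_set) auto

text \<open>Above, the values lie between 1 and \<open>s\<close>. Below, in the cubes with vertex 0
  and side \<open>(k + 1) * d\<close> the corner fills a fraction tending to 0, so the averages tend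
  to \<open>s\<close> while the essential infimum stays at most 1.\<close>

lemma A1_const_low_corner:
  assumes "0 < d" "1 \<le> s"
  shows "A1_const (low_corner d s :: real^'n \<Rightarrow> real) = ennreal s"
proof (rule antisym)
  show "A1_const (low_corner d s :: real^'n \<Rightarrow> real) \<le> ennreal s"
  proof (rule A1_const_le)
    fix a :: "real^'n" and l :: real assume "0 < l"
    then have "(\<integral>\<^sup>+x\<in>cbox a (\<chi> i. a $ i + l). ennreal (low_corner d s x) \<partial>lebesgue) \<le> ennreal (s * l ^ CARD('n))"
      using assms by (intro set_nn_integral_cube_le) (auto simp: low_corner_def)
    then show "\<exists>m>0. (\<forall>x\<in>cbox a (\<chi> i. a $ i + l). m \<le> low_corner d s x) \<and>
      (\<integral>\<^sup>+x\<in>cbox a (\<chi> i. a $ i + l). ennreal (low_corner d s x) \<partial>lebesgue) \<le> ennreal (s * m * l ^ CARD('n))"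
      using assms by (intro exI[of _ 1]) (auto simp: low_corner_def)
  qed (use assms in \<open>auto simp: low_corner_def\<close>)
  have "ennreal (s * (1 - (1 / real (Suc k)) ^ CARD('n))) \<le> A1_const (low_corner d s :: real^'n \<Rightarrow> real)" for k
  proof -
    define l where "l = real (Suc k) * d"
    have l: "0 < l" "d \<le> l"
      using assms by (auto simp: l_def mult_le_cancel_right1)
    have "ennreal (s * measure lebesgue (corner l - corner d :: (real^'n) set) / l ^ CARD('n) / 1)
        \<le> A1_const (low_corner d s :: real^'n \<Rightarrow> real)"
    proof (rule A1_const_ge[where B = "corner d" and a = 0])
      show "corner l - corner d \<subseteq> cbox 0 (\<chi> i. (0::real^'n) $ i + l)"
        by (auto simp: corner_def mem_box_cart less_imp_le)
      have "corner d \<subseteq> (corner l :: (real^'n) set)" by (rule corner_mono[OF l(2)])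
      then show "corner d \<subseteq> cbox 0 (\<chi> i. (0::real^'n) $ i + l)"
        by (auto simp: corner_def mem_box_cart less_imp_le subset_eq)
    qed (use assms l in \<open>auto simp: low_corner_def corner_lmeasurable measure_corner fmeasurable.Diff\<close>)
    also have "s * measure lebesgue (corner l - corner d :: (real^'n) set) / l ^ CARD('n) / 1
        = s * (1 - (1 / real (Suc k)) ^ CARD('n))"
      using assms l by (subst measure_corner_diff)
        (auto simp: l_def power_mult_distrib power_divide field_simps simp del: of_nat_Suc)
    finally show ?thesis .
  qed
  moreover have "(\<lambda>k. s * (1 - (1 / real (Suc k)) ^ CARD('n))) \<longlonglongrightarrow> s * (1 - 0 ^ CARD('n))"
    by (intro tendsto_intros LIMSEQ_Suc[OF lim_1_over_n])
  then have "(\<lambda>k. ennreal (s * (1 - (1 / real (Suc k)) ^ CARD('n)))) \<longlonglongrightarrow> ennreal s"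
    by (intro tendsto_ennrealI) (simp add: zero_power)
  ultimately show "ennreal s \<le> A1_const (low_corner d s :: real^'n \<Rightarrow> real)"
    by (intro LIMSEQ_le_const2) auto
qed

lemma low_corner_A1:
  assumes "0 < d" "1 \<le> s"
  shows "(low_corner d s :: real^'n \<Rightarrow> real) \<in> A1"
  using assms by (intro A1I[where m = 1 and M = s])
    (auto simp: low_corner_measurable A1_const_low_corner low_corner_def)

section \<open>The truncated power weight and its spike at the origin\<close>

lemma geometric_tail_le:
  fixes q :: real
  assumes "0 \<le> q" "q \<le> 1/2"
  shows "(\<Sum>k=j..J. q ^ k) \<le> 2 * q ^ j"
proof (cases "j \<le> J")
  case True
  have "(1 - q) * (\<Sum>k=j..J. q ^ k) = q ^ j - q ^ Suc J"
    using sum_gp_multiplied[OF True, of q] .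
  also have "\<dots> \<le> q ^ j" using assms by simp
  finally have "(1 - q) * (\<Sum>k=j..J. q ^ k) \<le> q ^ j" .
  moreover have "(1/2) * (\<Sum>k=j..J. q ^ k) \<le> (1 - q) * (\<Sum>k=j..J. q ^ k)"
    using assms by (intro mult_right_mono sum_nonneg) auto
  ultimately show ?thesis by linarith
qed (use assms in simp)

lemma two_le_power_card: "(2::real) \<le> 2 ^ CARD('n::finite)"
proof -
  have "1 \<le> CARD('n)" using zero_less_card_finite[where 'a = 'n] by linarith
  then have "(2::real) ^ 1 \<le> 2 ^ CARD('n)" by (intro power_increasing) auto
  then show ?thesis by (simp only: power_one_right)
qed

lemma half_power_card_le: "(1 / 2 ^ CARD('n::finite) :: real) \<le> 1/2"
  by (rule divide_left_mono[OF two_le_power_card]) auto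

text \<open>The last layer is the whole space; this keeps the weight built from the layers bounded
  below by a positive constant.\<close>

definition layer :: "nat \<Rightarrow> nat \<Rightarrow> (real^'n) set" where
  "layer J k = (if k < J then {x. \<forall>i. \<bar>x $ i\<bar> < 2 ^ k} else UNIV)"

text \<open>A step version of min(1, |x|^(-N)) in the maximum norm: at a point whose first layer is
  \<open>j\<close>, the sum is a geometric tail between \<open>q ^ j\<close> and
  \<open>2 * q ^ j\<close>, where q = 2^(-N).\<close>

definition staircase :: "nat \<Rightarrow> real^'n \<Rightarrow> real" where
  "staircase J x = (\<Sum>k\<le>J. (1 / 2 ^ CARD('n)) ^ k * indicator (layer J k) x)"

text \<open>The largest value of \<open>staircase\<close>, taken on \<open>layer J 0\<close>. The
  type argument carries the dimension, which the other types do not mention.\<close>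

definition peak :: "'n itself \<Rightarrow> nat \<Rightarrow> real" where
  "peak _ J = (\<Sum>k\<le>J. (1 / 2 ^ CARD('n)) ^ k)"

text \<open>For \<open>d \<le> 1/2\<close> the corner lies in \<open>layer J 0\<close>, where
  \<open>staircase\<close> equals \<open>peak\<close>, so the added term multiplies the weight by
  \<open>t\<close> there. The additive form keeps the weight a combination of indicators.\<close>

definition spiked :: "nat \<Rightarrow> real \<Rightarrow> real \<Rightarrow> real^'n \<Rightarrow> real" where
  "spiked J d t x = staircase J x + (t - 1) * peak TYPE('n) J * indicator (corner d) x"

lemma layer_sets: "(layer J k :: (real^'n) set) \<in> sets lebesgue"
proof -
  have "{x::real^'n. \<forall>i. \<bar>x $ i\<bar> < 2 ^ k} \<in> sets borel" by measurable
  then show ?thesis by (simp add: layer_def)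
qed

lemma layer_mono: "j \<le> k \<Longrightarrow> layer J j \<subseteq> layer J k"
  by (auto simp: layer_def intro: less_le_trans power_increasing)

text \<open>The layers increase, so a point of layer \<open>i\<close> collects every term from
  \<open>i\<close> on.\<close>

lemma staircase_layer_ge:
  assumes "i \<le> J" "x \<in> layer J i"
  shows "(\<Sum>k=i..J. (1 / 2 ^ CARD('n)) ^ k) \<le> staircase J (x :: real^'n)"
proof -
  have "(\<Sum>k=i..J. (1 / 2 ^ CARD('n)) ^ k) = (\<Sum>k=i..J. (1 / 2 ^ CARD('n)) ^ k * indicator (layer J k) x :: real)"
  proof (rule sum.cong)
    fix k assume "k \<in> {i..J}"
    then have "x \<in> layer J k" using assms layer_mono[of i k J] by auto
    then show "(1 / 2 ^ CARD('n)) ^ k = (1 / 2 ^ CARD('n)) ^ k * (indicator (layer J k) x :: real)" by simp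
  qed simp
  also have "\<dots> \<le> staircase J x"
    unfolding staircase_def by (intro sum_mono2) auto
  finally show ?thesis .
qed

lemma staircase_eq_peak:
  assumes "x \<in> layer J 0"
  shows "staircase J (x :: real^'n) = peak TYPE('n) J"
  unfolding staircase_def peak_def
  by (intro sum.cong) (use assms layer_mono[of 0 _ J] in \<open>auto simp: indicator_def\<close>)

lemma staircase_le:
  assumes "\<And>k. k < j \<Longrightarrow> x \<notin> layer J k"
  shows "staircase J (x :: real^'n) \<le> 2 * (1 / 2 ^ CARD('n)) ^ j"
proof -
  have "staircase J x \<le> (\<Sum>k=j..J. (1 / 2 ^ CARD('n)) ^ k)"
    unfolding staircase_def
  proof (subst sum.mono_neutral_right[where S = "{j..J}"])
    show "(\<Sum>k=j..J. (1 / 2 ^ CARD('n)) ^ k * indicator (layer J k) x) \<le> (\<Sum>k=j..J. (1 / 2 ^ CARD('n)) ^ k :: real)"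
      by (intro sum_mono) (auto simp: indicator_def)
  qed (use assms in auto)
  also have "\<dots> \<le> 2 * (1 / 2 ^ CARD('n)) ^ j"
    by (rule geometric_tail_le[OF _ half_power_card_le]) simp
  finally show ?thesis .
qed

lemma staircase_ge:
  "(1 / 2 ^ CARD('n)) ^ J \<le> staircase J (x :: real^'n)"
  using staircase_layer_ge[of J J x] by (simp add: layer_def)

lemma peak_bounds: "1 \<le> peak TYPE('n::finite) J" "peak TYPE('n) J \<le> 2"
proof -
  have "(\<Sum>k\<in>{0}. (1 / 2 ^ CARD('n)) ^ k) \<le> (\<Sum>k\<le>J. (1 / 2 ^ CARD('n)) ^ k :: real)"
    by (intro sum_mono2) auto
  then show "1 \<le> peak TYPE('n) J" by (simp add: peak_def)
  show "peak TYPE('n) J \<le> 2"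
    using geometric_tail_le[of "1 / 2 ^ CARD('n)" 0 J] half_power_card_le[where 'n = 'n]
    by (simp add: peak_def atLeast0AtMost)
qed

lemma staircase_le_peak: "staircase J (x :: real^'n) \<le> peak TYPE('n) J"
  unfolding staircase_def peak_def by (intro sum_mono) (auto simp: indicator_def)

lemma spiked_measurable: "(spiked J d t :: real^'n \<Rightarrow> real) \<in> borel_measurable lebesgue"
  unfolding spiked_def staircase_def
  by (intro borel_measurable_add borel_measurable_sum borel_measurable_times borel_measurable_const
      borel_measurable_indicator layer_sets fmeasurableD[OF corner_lmeasurable])

lemma spiked_ge_staircase: "1 \<le> t \<Longrightarrow> staircase J x \<le> spiked J d t (x :: real^'n)"
  using peak_bounds(1)[of J, where 'n = 'n] by (simp add: spiked_def)

lemma spiked_ge: "1 \<le> t \<Longrightarrow> (1 / 2 ^ CARD('n)) ^ J \<le> spiked J d t (x :: real^'n)"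
  using staircase_ge spiked_ge_staircase by (rule order_trans)

lemma spiked_pos: "1 \<le> t \<Longrightarrow> 0 < spiked J d t (x :: real^'n)"
  by (rule less_le_trans[OF _ spiked_ge]) simp_all

lemma set_nn_integral_spiked:
  assumes "Q \<in> lmeasurable" "1 \<le> t"
  shows "(\<integral>\<^sup>+x\<in>Q. ennreal (spiked J d t (x :: real^'n)) \<partial>lebesgue)
    = ennreal ((\<Sum>k\<le>J. (1 / 2 ^ CARD('n)) ^ k * measure lebesgue (layer J k \<inter> Q))
        + (t - 1) * peak TYPE('n) J * measure lebesgue (corner d \<inter> Q))"
proof -
  \<comment> \<open>The spike is treated as one more term, with index \<open>Suc J\<close>.\<close>
  define c where "c k = (if k \<le> J then (1 / 2 ^ CARD('n)) ^ k else (t - 1) * peak TYPE('n) J)" for k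
  define S :: "nat \<Rightarrow> (real^'n) set" where "S k = (if k \<le> J then layer J k else corner d)" for k
  have "spiked J d t x = (\<Sum>k\<le>Suc J. c k * indicator (S k) x)" for x
    by (simp add: spiked_def staircase_def c_def S_def)
  then have "(\<integral>\<^sup>+x\<in>Q. ennreal (spiked J d t x) \<partial>lebesgue)
      = (\<integral>\<^sup>+x\<in>Q. ennreal (\<Sum>k\<le>Suc J. c k * indicator (S k) x) \<partial>lebesgue)"
    by simp
  also have "\<dots> = ennreal (\<Sum>k\<le>Suc J. c k * measure lebesgue (S k \<inter> Q))"
    using assms peak_bounds(1)[of J, where 'n = 'n]
    by (intro set_nn_integral_indicator_sum)
      (auto simp: S_def c_def layer_sets fmeasurableD[OF corner_lmeasurable])
  also have "(\<Sum>k\<le>Suc J. c k * measure lebesgue (S k \<inter> Q))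
      = (\<Sum>k\<le>J. (1 / 2 ^ CARD('n)) ^ k * measure lebesgue (layer J k \<inter> Q))
        + (t - 1) * peak TYPE('n) J * measure lebesgue (corner d \<inter> Q)"
    by (simp add: c_def S_def)
  finally show ?thesis .
qed

section \<open>The A1 constant of the spiked weight\<close>

text \<open>Serves to bound sides from below: a cube with one point near the origin and another far
  out must be long.\<close>

lemma cube_coord_diff_le:
  assumes "x \<in> cbox a (\<chi> i. a $ i + l)" "y \<in> cbox (a :: real^'n) (\<chi> i. a $ i + l)"
  shows "\<bar>x $ m\<bar> - \<bar>y $ m\<bar> \<le> l"
proof -
  have "a $ m \<le> x $ m" "x $ m \<le> a $ m + l" "a $ m \<le> y $ m" "y $ m \<le> a $ m + l"
    using assms by (auto simp: mem_box_cart)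
  then show ?thesis by linarith
qed

text \<open>A layer below the first one that contains the cube \<open>Q\<close> contributes little to the integral
  over \<open>Q\<close>: unless it is the next smaller one, the side of \<open>Q\<close> is at least \<open>2 ^ (i - 2)\<close>.\<close>

lemma layer_cube_le:
  fixes a :: "real^'n" and l :: real
  defines "Q \<equiv> cbox a (\<chi> i. a $ i + l)"
  assumes l: "0 < l" and k: "k < i" and i: "i \<le> J" and out: "\<not> Q \<subseteq> layer J (i - 1)"
  shows "(1 / 2 ^ CARD('n)) ^ k * measure lebesgue (layer J k \<inter> Q)
    \<le> 8 ^ CARD('n) * ((1 / 2 ^ CARD('n)) ^ i * l ^ CARD('n))"
proof (cases "layer J k \<inter> Q = {}")
  case True
  then show ?thesis using l by simp
next
  case False
  have measQ: "measure lebesgue (layer J k \<inter> Q) \<le> l ^ CARD('n)"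
  proof -
    have "measure lebesgue (layer J k \<inter> Q) \<le> measure lebesgue Q"
      by (rule measure_mono_fmeasurable) (auto simp: Q_def intro!: sets.Int layer_sets)
    then show ?thesis using l by (simp only: Q_def measure_cube less_imp_le)
  qed
  show ?thesis
  proof (cases "k = i - 1")
    case True
    \<comment> \<open>For neighbouring layers the coefficients differ only by the factor 2^N, so the
      trivial bound on the volume suffices.\<close>
    then have "(1 / 2 ^ CARD('n)) ^ k = 2 ^ CARD('n) * (1 / 2 ^ CARD('n) :: real) ^ i"
      using k by (cases i) auto
    also have "\<dots> \<le> 8 ^ CARD('n) * (1 / 2 ^ CARD('n)) ^ i"
      by (intro mult_right_mono power_mono) auto
    finally have "(1 / 2 ^ CARD('n)) ^ k * measure lebesgue (layer J k \<inter> Q)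
        \<le> (8 ^ CARD('n) * (1 / 2 ^ CARD('n)) ^ i) * l ^ CARD('n)"
      using measQ by (intro mult_mono) auto
    then show ?thesis by (simp add: mult.assoc)
  next
    case False': False
    obtain y where y: "y \<in> layer J k" "y \<in> Q" using False by blast
    obtain x where x: "x \<in> Q" "x \<notin> layer J (i - 1)" using out by blast
    then obtain m where m: "2 ^ (i - 1) \<le> \<bar>x $ m\<bar>"
      using i k by (auto simp: layer_def not_less split: if_splits)
    have "\<bar>y $ m\<bar> < 2 ^ k"
      using y(1) i k by (auto simp: layer_def)
    then have "2 ^ (i - 1) - 2 ^ k \<le> l"
      using cube_coord_diff_le[of x a l y m] x y m unfolding Q_def by linarith
    moreover obtain i' where i': "i = Suc (Suc i')" "k \<le> i'"
    proof (rule that)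
      show "i = Suc (Suc (i - 2))" "k \<le> i - 2" using False' k by linarith+
    qed
    moreover have "(2::real) ^ k \<le> 2 ^ i'"
      using i' by (intro power_increasing) auto
    moreover have "(2::real) ^ i = 4 * 2 ^ i'" "(2::real) ^ (i - 1) = 2 * 2 ^ i'"
      using i' by auto
    ultimately have l4: "2 ^ i \<le> 4 * l" by linarith
    \<comment> \<open>The whole layer has volume 2^N 2^(kN), and its coefficient cancels the second
      factor.\<close>
    have "measure lebesgue (layer J k \<inter> Q) \<le> measure lebesgue (cbox (\<chi> j. - (2 ^ k)) (\<chi> j. (\<chi> j. - (2 ^ k) :: real^'n) $ j + 2 * 2 ^ k))"
      using i k by (intro measure_mono_fmeasurable)
        (auto simp: Q_def layer_def mem_box_cart abs_less_iff less_imp_le minus_less_iff intro!: sets.Int layer_sets[of J k, unfolded layer_def] dest: spec)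
    also have "\<dots> = (2 * 2 ^ k) ^ CARD('n)"
      by (rule measure_cube) simp
    finally have "(1 / 2 ^ CARD('n)) ^ k * measure lebesgue (layer J k \<inter> Q)
        \<le> (1 / 2 ^ CARD('n)) ^ k * (2 * 2 ^ k) ^ CARD('n)"
      by (intro mult_left_mono) auto
    also have "\<dots> = 2 ^ CARD('n)"
      by (simp add: power_mult_distrib power_divide mult.commute flip: power_mult)
    \<comment> \<open>The constant 8 originates here: \<open>l4\<close> says exactly that 2 is at
      most \<open>8 * (l / 2 ^ i)\<close>.\<close>
    also have "\<dots> \<le> (8 * (l / 2 ^ i)) ^ CARD('n)"
      using l4 by (intro power_mono) (auto simp: field_simps)
    also have "\<dots> = 8 ^ CARD('n) * ((1 / 2 ^ CARD('n)) ^ i * l ^ CARD('n))"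
      by (simp add: power_mult_distrib power_divide flip: power_mult)
    finally show ?thesis .
  qed
qed
text \<open>The spike has total mass at most 2, by the smallness of \<open>d\<close>. A cube that
  meets the corner and leaves layer \<open>i - 1\<close> has side at least 2^(i-1) - 1/2, hence at
  least 2^i / 4, so the right-hand side is at least 2^N.\<close>

lemma spike_cube_le:
  fixes a :: "real^'n" and l :: real
  defines "Q \<equiv> cbox a (\<chi> i. a $ i + l)"
  assumes l: "0 < l" and i: "0 < i" "i \<le> J" and out: "\<not> Q \<subseteq> layer J (i - 1)"
    and d: "0 < d" "d \<le> 1/2" and t: "1 \<le> t" "(t - 1) * d ^ CARD('n) \<le> 1"
  shows "(t - 1) * peak TYPE('n) J * measure lebesgue (corner d \<inter> Q)
    \<le> 8 ^ CARD('n) * ((1 / 2 ^ CARD('n)) ^ i * l ^ CARD('n))"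
proof (cases "corner d \<inter> Q = {}")
  case True
  then show ?thesis using l by simp
next
  case False
  then obtain y where y: "y \<in> corner d" "y \<in> Q" by blast
  obtain x where x: "x \<in> Q" "x \<notin> layer J (i - 1)" using out by blast
  then obtain m where m: "2 ^ (i - 1) \<le> \<bar>x $ m\<bar>"
    using i by (auto simp: layer_def not_less split: if_splits)
  have "\<bar>y $ m\<bar> < 1/2"
    using y(1) d unfolding corner_def by (auto dest!: spec[of _ m])
  then have "2 ^ (i - 1) - 1/2 \<le> l"
    using cube_coord_diff_le[of x a l y m] x y m unfolding Q_def by linarith
  moreover have "(1::real) \<le> 2 ^ (i - 1)" by simp
  moreover have "(2::real) ^ i = 2 * 2 ^ (i - 1)" using i by (cases i) auto
  ultimately have l4: "2 ^ i \<le> 4 * l" by linarith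
  have "measure lebesgue (corner d \<inter> Q) \<le> d ^ CARD('n)"
    unfolding measure_corner[OF less_imp_le[OF d(1)], where 'n = 'n, symmetric]
    by (rule measure_mono_fmeasurable)
      (auto simp: Q_def intro!: sets.Int corner_lmeasurable fmeasurableD[OF corner_lmeasurable])
  then have "(t - 1) * peak TYPE('n) J * measure lebesgue (corner d \<inter> Q)
      \<le> (t - 1) * peak TYPE('n) J * d ^ CARD('n)"
    using t peak_bounds(1)[of J, where 'n = 'n] by (intro mult_left_mono) auto
  also have "\<dots> = peak TYPE('n) J * ((t - 1) * d ^ CARD('n))" by simp
  also have "\<dots> \<le> 2 * 1"
    using t d peak_bounds[of J, where 'n = 'n] by (intro mult_mono) auto
  also have "\<dots> \<le> 2 ^ CARD('n)"
    using two_le_power_card[where 'n = 'n] by (simp only: mult_1_right)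
  also have "\<dots> \<le> (8 * (l / 2 ^ i)) ^ CARD('n)"
    using l4 by (intro power_mono) (auto simp: field_simps)
  also have "\<dots> = 8 ^ CARD('n) * ((1 / 2 ^ CARD('n)) ^ i * l ^ CARD('n))"
    by (simp add: power_mult_distrib power_divide flip: power_mult)
  finally show ?thesis .
qed

lemma spiked_le_peak:
  assumes "1 \<le> t"
  shows "spiked J d t (x :: real^'n) \<le> t * peak TYPE('n) J"
proof -
  have "(t - 1) * peak TYPE('n) J * indicator (corner d) x \<le> (t - 1) * peak TYPE('n) J * 1"
    using assms peak_bounds(1)[of J, where 'n = 'n] by (intro mult_left_mono) auto
  then show ?thesis
    using staircase_le_peak[of J x] by (simp add: spiked_def algebra_simps)
qed

lemma spiked_corner:
  assumes "d \<le> 1/2" "x \<in> corner d"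
  shows "spiked J d t (x :: real^'n) = t * peak TYPE('n) J"
proof -
  have "x \<in> layer J 0"
    using assms unfolding corner_def layer_def by (auto intro: less_le_trans)
  then show ?thesis
    using assms by (simp add: spiked_def staircase_eq_peak algebra_simps)
qed

text \<open>If the cube lies in \<open>layer J 0\<close>, the weight is between \<open>peak\<close>
  and \<open>t * peak\<close> on it. Otherwise let \<open>i\<close> be the first layer containing
  the cube and \<open>m\<close> the tail from \<open>i\<close> on, a lower bound for the weight.
  Layers from \<open>i\<close> on contribute at most \<open>m\<close> times the volume; the spike
  and each of the at most \<open>J\<close> earlier layers contribute at most 8^N times that.\<close>

lemma A1_const_spiked_le:
  assumes d: "0 < d" "d \<le> 1/2" and t: "1 \<le> t" "(t - 1) * d ^ CARD('n) \<le> 1"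
    and J: "J = 0 \<or> 1 + 8 ^ CARD('n) * real (J + 1) \<le> t"
  shows "A1_const (spiked J d t :: real^'n \<Rightarrow> real) \<le> ennreal t"
proof (rule A1_const_le)
  show "0 \<le> spiked J d t x" for x :: "real^'n"
    using spiked_pos[OF t(1)] by (rule less_imp_le)
  fix a :: "real^'n" and l :: real assume l: "0 < l"
  define Q where "Q = cbox a (\<chi> i. a $ i + l)"
  define q :: real where "q = 1 / 2 ^ CARD('n)"
  have q: "0 < q" by (simp add: q_def)
  have "\<exists>m>0. (\<forall>x\<in>Q. m \<le> spiked J d t x) \<and>
      (\<integral>\<^sup>+x\<in>Q. ennreal (spiked J d t x) \<partial>lebesgue) \<le> ennreal (t * m * l ^ CARD('n))"
  proof (cases "Q \<subseteq> layer J 0")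
    case True
    have "peak TYPE('n) J \<le> spiked J d t x" if "x \<in> Q" for x
      using True that staircase_eq_peak[of x J] spiked_ge_staircase[OF t(1), of J x d] by auto
    moreover have "(\<integral>\<^sup>+x\<in>Q. ennreal (spiked J d t x) \<partial>lebesgue) \<le> ennreal (t * peak TYPE('n) J * l ^ CARD('n))"
      unfolding Q_def using t l peak_bounds(1)[of J, where 'n = 'n]
      by (intro set_nn_integral_cube_le spiked_le_peak) auto
    ultimately show ?thesis
      using peak_bounds(1)[of J, where 'n = 'n] by (intro exI[of _ "peak TYPE('n) J"]) auto
  next
    case False
    define i where "i = (LEAST k. Q \<subseteq> layer J k)"
    have "Q \<subseteq> layer J J" by (simp add: layer_def)
    then have i: "Q \<subseteq> layer J i" "i \<le> J"
      unfolding i_def by (rule LeastI[of "\<lambda>k. Q \<subseteq> layer J k"], rule Least_le)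
    have "0 < i" using i(1) False by (cases i) auto
    then have out: "\<not> Q \<subseteq> layer J (i - 1)"
      unfolding i_def by (intro not_less_Least) simp
    \<comment> \<open>Here \<open>0 < i \<le> J\<close>, so the alternative \<open>J = 0\<close> is
      excluded: in that case the only layer is the whole space.\<close>
    have Jt: "1 + 8 ^ CARD('n) * real (J + 1) \<le> t" using J i(2) \<open>0 < i\<close> by auto
    define m where "m = (\<Sum>k=i..J. q ^ k)"
    have qm: "q ^ i \<le> m"
      unfolding m_def using i(2) q by (intro member_le_sum) auto
    then have m: "0 < m" using q by (meson less_le_trans zero_less_power)
    have below: "m \<le> spiked J d t x" if "x \<in> Q" for x
      using staircase_layer_ge[OF i(2), of x] i(1) that spiked_ge_staircase[OF t(1), of J x d]
      by (auto simp: m_def q_def)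
    have measQ: "measure lebesgue (layer J k \<inter> Q) \<le> l ^ CARD('n)" for k
    proof -
      have "measure lebesgue (layer J k \<inter> Q) \<le> measure lebesgue Q"
        by (rule measure_mono_fmeasurable) (auto simp: Q_def intro!: sets.Int layer_sets)
      then show ?thesis using l by (simp only: Q_def measure_cube less_imp_le)
    qed
    \<comment> \<open>A common bound for one earlier layer and for the spike.\<close>
    define E where "E = 8 ^ CARD('n) * (m * l ^ CARD('n))"
    have E: "8 ^ CARD('n) * (q ^ i * l ^ CARD('n)) \<le> E"
      unfolding E_def using qm l by (intro mult_left_mono mult_right_mono) auto
    have "(\<Sum>k\<le>J. q ^ k * measure lebesgue (layer J k \<inter> Q))
        = (\<Sum>k<i. q ^ k * measure lebesgue (layer J k \<inter> Q)) + (\<Sum>k=i..J. q ^ k * measure lebesgue (layer J k \<inter> Q))"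
      using i(2) by (subst sum.union_disjoint[symmetric]) (auto intro!: sum.cong)
    also have "(\<Sum>k<i. q ^ k * measure lebesgue (layer J k \<inter> Q)) \<le> (\<Sum>k<i. E)"
      using layer_cube_le[OF l _ i(2), of _ a] out E unfolding Q_def q_def
      by (intro sum_mono) (auto intro: order_trans)
    also have "\<dots> \<le> real J * E"
      using i(2) m l by (auto simp: E_def intro!: mult_right_mono)
    also have "(\<Sum>k=i..J. q ^ k * measure lebesgue (layer J k \<inter> Q)) \<le> m * l ^ CARD('n)"
      unfolding m_def sum_distrib_right using q measQ by (intro sum_mono mult_left_mono) auto
    finally have "(\<Sum>k\<le>J. q ^ k * measure lebesgue (layer J k \<inter> Q)) \<le> real J * E + m * l ^ CARD('n)"
      by simp
    moreover have "(t - 1) * peak TYPE('n) J * measure lebesgue (corner d \<inter> Q) \<le> E"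
      using spike_cube_le[OF l \<open>0 < i\<close> i(2) _ d t, of a] out E unfolding Q_def q_def by linarith
    ultimately have "(\<Sum>k\<le>J. q ^ k * measure lebesgue (layer J k \<inter> Q))
        + (t - 1) * peak TYPE('n) J * measure lebesgue (corner d \<inter> Q)
      \<le> (1 + 8 ^ CARD('n) * real (J + 1)) * (m * l ^ CARD('n))"
      by (simp add: E_def algebra_simps)
    also have "\<dots> \<le> t * (m * l ^ CARD('n))"
      using Jt m l by (intro mult_right_mono) auto
    finally have "(\<integral>\<^sup>+x\<in>Q. ennreal (spiked J d t x) \<partial>lebesgue) \<le> ennreal (t * m * l ^ CARD('n))"
      using t(1) by (subst set_nn_integral_spiked) (auto simp: Q_def q_def mult.assoc intro!: ennreal_leI)
    then show ?thesis using m below by blast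
  qed
  then show "\<exists>m>0. (\<forall>x\<in>cbox a (\<chi> i. a $ i + l). m \<le> spiked J d t x) \<and>
      (\<integral>\<^sup>+x\<in>cbox a (\<chi> i. a $ i + l). ennreal (spiked J d t x) \<partial>lebesgue) \<le> ennreal (t * m * l ^ CARD('n))"
    unfolding Q_def .
qed (use t in simp)

text \<open>The cube [-e,d]^N is little more than the corner, so its average is nearly
  \<open>t * peak\<close> or larger, yet it contains points off the corner, where the weight is at
  most \<open>peak\<close>. Letting e tend to 0 gives the exact constant.\<close>

lemma A1_const_spiked_ge:
  assumes d: "0 < d" "d \<le> 1/2" and t: "1 \<le> t"
  shows "ennreal t \<le> A1_const (spiked J d t :: real^'n \<Rightarrow> real)"
proof -
  have "ennreal (t * (1 / (1 + 1 / real (Suc k))) ^ CARD('n)) \<le> A1_const (spiked J d t :: real^'n \<Rightarrow> real)" for k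
  proof -
    define e where "e = d / real (Suc k)"
    have e: "0 < e" "e \<le> d"
      using d by (auto simp: e_def divide_simps)
    define l where "l = d + e"
    define b :: "real^'n" where "b = (\<chi> i. - e)"
    have "ennreal (t * peak TYPE('n) J * measure lebesgue (corner d :: (real^'n) set) / l ^ CARD('n) / peak TYPE('n) J)
        \<le> A1_const (spiked J d t :: real^'n \<Rightarrow> real)"
    \<comment> \<open>The small cube at the lowest vertex has only negative coordinates, hence
      misses the corner.\<close>
    proof (rule A1_const_ge[where B = "cbox b (\<chi> i. b $ i + e / 2)" and a = b])
      show "0 < measure lebesgue (cbox b (\<chi> i. b $ i + e / 2))"
        using e by (subst measure_cube) auto
      show "corner d \<subseteq> cbox b (\<chi> i. b $ i + l)"
      proof (clarsimp simp: mem_box_cart b_def l_def corner_def)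
        fix x :: "real^'n" and i assume "\<forall>i. 0 \<le> x $ i \<and> x $ i < d"
        then have "0 \<le> x $ i" "x $ i < d" by auto
        then show "- e \<le> x $ i \<and> x $ i \<le> d" using e by linarith
      qed
      show "cbox b (\<chi> i. b $ i + e / 2) \<subseteq> cbox b (\<chi> i. b $ i + l)"
      proof
        fix x assume x: "x \<in> cbox b (\<chi> i. b $ i + e / 2)"
        then have "- e \<le> x $ i" "x $ i \<le> d" for i
          using e d by (auto simp: b_def mem_box_cart dest!: spec[of _ i])
        then show "x \<in> cbox b (\<chi> i. b $ i + l)"
          by (simp add: b_def l_def mem_box_cart)
      qed
      show "t * peak TYPE('n) J \<le> spiked J d t x" if "x \<in> corner d" for x :: "real^'n"
        using spiked_corner[OF d(2) that] by simp
      show "spiked J d t x \<le> peak TYPE('n) J" if "x \<in> cbox b (\<chi> i. b $ i + e / 2)" for x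
      proof -
        have "x $ i < 0" for i
          using that e by (auto simp: b_def mem_box_cart dest!: spec[of _ i])
        then have "x \<notin> corner d" by (auto simp: corner_def not_le)
        then show ?thesis using staircase_le_peak[of J x] by (simp add: spiked_def)
      qed
    qed (use e d t peak_bounds(1)[of J, where 'n = 'n] in \<open>auto simp: l_def corner_lmeasurable\<close>)
    also have "t * peak TYPE('n) J * measure lebesgue (corner d :: (real^'n) set) / l ^ CARD('n) / peak TYPE('n) J
        = t * (1 / (1 + 1 / real (Suc k))) ^ CARD('n)"
    proof -
      have "l = d * (1 + 1 / real (Suc k))" by (simp add: l_def e_def algebra_simps)
      then have "l ^ CARD('n) = d ^ CARD('n) * (1 + 1 / real (Suc k)) ^ CARD('n)"
        by (simp only: power_mult_distrib)
      then show ?thesis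
        using d peak_bounds(1)[of J, where 'n = 'n] by (simp add: measure_corner power_divide)
    qed
    finally show ?thesis .
  qed
  moreover have "(\<lambda>k. t * (1 / (1 + 1 / real (Suc k))) ^ CARD('n)) \<longlonglongrightarrow> t * (1 / (1 + 0)) ^ CARD('n)"
    by (intro tendsto_intros LIMSEQ_Suc[OF lim_1_over_n]) auto
  then have "(\<lambda>k. ennreal (t * (1 / (1 + 1 / real (Suc k))) ^ CARD('n))) \<longlonglongrightarrow> ennreal t"
    by (intro tendsto_ennrealI) simp
  ultimately show "ennreal t \<le> A1_const (spiked J d t :: real^'n \<Rightarrow> real)"
    by (intro LIMSEQ_le_const2) auto
qed

lemma spiked_A1:
  assumes "0 < d" "d \<le> 1/2" "1 \<le> t" "(t - 1) * d ^ CARD('n) \<le> 1"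
    and "J = 0 \<or> 1 + 8 ^ CARD('n) * real (J + 1) \<le> t"
  shows "(spiked J d t :: real^'n \<Rightarrow> real) \<in> A1"
proof (rule A1I)
  show "(1 / 2 ^ CARD('n)) ^ J \<le> spiked J d t x" for x :: "real^'n"
    by (rule spiked_ge[OF assms(3)])
  show "spiked J d t x \<le> t * peak TYPE('n) J" for x :: "real^'n"
    by (rule spiked_le_peak[OF assms(3)])
  show "A1_const (spiked J d t :: real^'n \<Rightarrow> real) < \<infinity>"
    using A1_const_spiked_le[OF assms] by (simp add: le_less_trans)
qed (simp_all add: spiked_measurable)

section \<open>The test function: maximal quotient, weighted measure and norm\<close>

text \<open>It suffices to average over the dyadic cube \<open>corner (2 ^ j)\<close>, which
  contains both \<open>x\<close> and the small corner.\<close>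

lemma dyadic_maximal_corner_ge:
  assumes d: "0 < d" "d \<le> 2 ^ j" and x: "x \<in> corner (2 ^ j)"
  shows "ennreal (d ^ CARD('n) * (1 / 2 ^ CARD('n)) ^ j)
    \<le> dyadic_maximal (indicator (corner d)) (x :: real^'n)"
proof -
  define P :: "(real^'n) set" where "P = corner (2 ^ j)"
  have "P = {x. \<forall>i. 2 powi int j * real_of_int ((\<lambda>_. 0) i) \<le> x $ i
      \<and> x $ i < 2 powi int j * (real_of_int ((\<lambda>_. 0) i) + 1)}"
    by (simp add: P_def corner_def)
  then have P: "P \<in> dyadic_cubes"
    unfolding dyadic_cubes_def by (intro CollectI exI[of _ "int j"] exI[of _ "\<lambda>_. 0"]) simp
  have "(\<integral>\<^sup>+x\<in>P. ennreal \<bar>indicator (corner d) x\<bar> \<partial>lebesgue)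
      = (\<integral>\<^sup>+x. indicator (corner d) (x :: real^'n) \<partial>lebesgue)"
    using corner_mono[OF d(2), where 'a = 'n]
    by (intro nn_integral_cong) (auto simp: P_def indicator_def)
  also have "\<dots> = ennreal (d ^ CARD('n))"
    using d by (simp add: fmeasurableD[OF corner_lmeasurable] emeasure_eq_measure2[OF corner_lmeasurable] measure_corner)
  finally have "average P (indicator (corner d)) = ennreal (d ^ CARD('n)) / ennreal ((2 ^ j) ^ CARD('n))"
    by (simp add: average_def P_def emeasure_eq_measure2[OF corner_lmeasurable] measure_corner)
  also have "\<dots> = ennreal (d ^ CARD('n) * (1 / 2 ^ CARD('n)) ^ j)"
    using d by (simp add: divide_ennreal power_divide mult.commute flip: power_mult)
  finally have "average P (indicator (corner d)) = ennreal (d ^ CARD('n) * (1 / 2 ^ CARD('n)) ^ j)" .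
  moreover have "average P (indicator (corner d)) \<le> dyadic_maximal (indicator (corner d)) x"
    unfolding dyadic_maximal_def using P x by (intro SUP_upper) (simp add: P_def)
  ultimately show ?thesis by simp
qed

text \<open>If \<open>corner (2 ^ j)\<close> is the first such corner containing \<open>x\<close>,
  the maximal function is at least \<open>d ^ N * q ^ j\<close> and the weight at most
  \<open>2 * q ^ j\<close>. The quotient is thus at least \<open>d ^ N / 2\<close>; a quarter leaves
  room for the strict inequality.\<close>

lemma dyadic_maximal_over_spiked_gt:
  assumes d: "0 < d" "d \<le> 1/2" and t: "1 \<le> t" and x: "x \<in> corner (2 ^ J) - corner d"
  shows "ennreal (d ^ CARD('n) / 4)
    < dyadic_maximal (indicator (corner d)) x / ennreal (spiked J d t (x :: real^'n))"
proof -
  define q :: real where "q = 1 / 2 ^ CARD('n)"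
  have q: "0 < q" by (simp add: q_def)
  define j where "j = (LEAST k. x \<in> corner (2 ^ k))"
  have j: "x \<in> corner (2 ^ j)" "j \<le> J"
    unfolding j_def using x by (auto intro: LeastI Least_le)
  \<comment> \<open>The coordinates of \<open>x\<close> are nonnegative, so leaving the corner of
    side 2^k means leaving the layer; \<open>k < j \<le> J\<close> ensures that the layer is not the
    whole space.\<close>
  have "x \<notin> layer J k" if "k < j" for k
  proof -
    have "x \<notin> corner (2 ^ k)"
      using that unfolding j_def by (rule not_less_Least)
    moreover have "0 \<le> x $ i" for i using j(1) by (simp add: corner_def)
    ultimately show ?thesis using that j(2) by (auto simp: corner_def layer_def)
  qed
  then have "staircase J x \<le> 2 * q ^ j"
    unfolding q_def by (rule staircase_le)
  then have v: "spiked J d t x \<le> 2 * q ^ j"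
    using x by (simp add: spiked_def)
  have v0: "0 < spiked J d t x"
    by (rule spiked_pos[OF t])
  have "(1::real) \<le> 2 ^ j" by simp
  then have "d \<le> 2 ^ j" using d by linarith
  then have M: "ennreal (d ^ CARD('n) * q ^ j) \<le> dyadic_maximal (indicator (corner d)) x"
    using dyadic_maximal_corner_ge[OF d(1) _ j(1)] by (simp add: q_def)
  have "d ^ CARD('n) / 4 * spiked J d t x \<le> d ^ CARD('n) / 4 * (2 * q ^ j)"
    using v d by (intro mult_left_mono) auto
  also have "\<dots> < d ^ CARD('n) * q ^ j"
    using d q by simp
  finally have "d ^ CARD('n) / 4 < d ^ CARD('n) * q ^ j / spiked J d t x"
    using v0 by (simp add: pos_less_divide_eq)
  then have "ennreal (d ^ CARD('n) / 4) < ennreal (d ^ CARD('n) * q ^ j / spiked J d t x)"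
    using d by (intro ennreal_lessI) (auto intro: le_less_trans[of 0 "d ^ CARD('n) / 4"])
  also have "\<dots> = ennreal (d ^ CARD('n) * q ^ j) / ennreal (spiked J d t x)"
    using d q v0 by (simp add: divide_ennreal)
  also have "\<dots> \<le> dyadic_maximal (indicator (corner d)) x / ennreal (spiked J d t x)"
    using M by (rule divide_right_mono_ennreal)
  finally show ?thesis .
qed

text \<open>Layer \<open>k\<close> meets the region in a set containing
  \<open>corner (2 ^ k) - corner d\<close>. Its coefficient turns the volume 2^(kN) into 1, and at
  most 1/2 is lost to the removed corner.\<close>

lemma wmeasure_corner_diff_ge:
  assumes d: "0 < d" "d \<le> 1/2" and s: "1 \<le> s" and t: "1 \<le> t"
  shows "ennreal (s * (real (J + 1) / 2))
    \<le> wmeasure (\<lambda>x. low_corner d s x * spiked J d t (x :: real^'n)) (corner (2 ^ J) - corner d)"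
proof -
  define q :: real where "q = 1 / 2 ^ CARD('n)"
  have q: "0 < q" by (simp add: q_def)
  define E :: "(real^'n) set" where "E = corner (2 ^ J) - corner d"
  have E: "E \<in> lmeasurable" unfolding E_def by (intro fmeasurable.Diff corner_lmeasurable)
  have "1/2 \<le> q ^ k * measure lebesgue (layer J k \<inter> E)" if k: "k \<le> J" for k
  proof -
    have dk: "d \<le> 2 ^ k" using d one_le_power[of "2::real" k] by linarith
    have "corner (2 ^ k) \<subseteq> (corner (2 ^ J) :: (real^'n) set)"
      using k by (intro corner_mono power_increasing) auto
    moreover have "corner (2 ^ k) \<subseteq> (layer J k :: (real^'n) set)"
      by (auto simp: corner_def layer_def)
    ultimately have "measure lebesgue (corner (2 ^ k) - corner d :: (real^'n) set) \<le> measure lebesgue (layer J k \<inter> E)"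
      using E by (intro measure_mono_fmeasurable)
        (auto simp: E_def fmeasurableD[OF corner_lmeasurable] layer_sets intro: fmeasurable_Int_fmeasurable
          simp: inf_commute[of "layer J k"])
    then have "(2 ^ k) ^ CARD('n) - d ^ CARD('n) \<le> measure lebesgue (layer J k \<inter> E)"
      using d dk by (simp add: measure_corner_diff)
    then have "q ^ k * ((2 ^ k) ^ CARD('n) - d ^ CARD('n)) \<le> q ^ k * measure lebesgue (layer J k \<inter> E)"
      using q by (intro mult_left_mono) auto
    moreover have "q ^ k * (2 ^ k) ^ CARD('n) = 1"
      by (simp add: q_def power_divide mult.commute flip: power_mult)
    moreover have "q ^ k * d ^ CARD('n) \<le> 1 * (1/2)"
    proof (rule mult_mono)
      show "q ^ k \<le> 1" by (rule power_le_one) (auto simp: q_def)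
      have "d ^ CARD('n) \<le> d ^ 1"
        using d by (intro power_decreasing) (auto simp: Suc_le_eq)
      then show "d ^ CARD('n) \<le> 1/2" using d by simp
    qed (use d in auto)
    ultimately show ?thesis by (simp add: algebra_simps)
  qed
  then have "(\<Sum>k\<le>J. 1/2) \<le> (\<Sum>k\<le>J. q ^ k * measure lebesgue (layer J k \<inter> E))"
    by (intro sum_mono) auto
  also have "\<dots> \<le> (\<Sum>k\<le>J. q ^ k * measure lebesgue (layer J k \<inter> E))
        + (t - 1) * peak TYPE('n) J * measure lebesgue (corner d \<inter> E)"
    using t peak_bounds(1)[of J, where 'n = 'n] by simp
  finally have "ennreal (real (J + 1) / 2) \<le> (\<integral>\<^sup>+x\<in>E. ennreal (spiked J d t x) \<partial>lebesgue)"
    by (subst set_nn_integral_spiked[OF E t]) (auto simp: q_def intro!: ennreal_leI)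
  then have "ennreal s * ennreal (real (J + 1) / 2) \<le> ennreal s * (\<integral>\<^sup>+x\<in>E. ennreal (spiked J d t x) \<partial>lebesgue)"
    by (intro mult_left_mono) auto
  also have "\<dots> = (\<integral>\<^sup>+x. ennreal s * (ennreal (spiked J d t x) * indicator E x) \<partial>lebesgue)"
    using E spiked_measurable[of J d t, where 'n = 'n]
    by (intro nn_integral_cmult[symmetric] borel_measurable_times_ennreal borel_measurable_indicator) (auto simp: fmeasurableD)
  also have "\<dots> = wmeasure (\<lambda>x. low_corner d s x * spiked J d t x) E"
    unfolding wmeasure_def using s
    by (intro nn_integral_cong) (auto simp: E_def low_corner_def indicator_def ennreal_mult')
  finally show ?thesis
    using s by (subst ennreal_mult) (auto simp: E_def)
qed

text \<open>The factor \<open>spiked\<close> cancels and \<open>low_corner\<close> is 1 where the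
  test function lives, so neither \<open>s\<close> nor \<open>t\<close> enters the norm.\<close>

lemma L1_norm_low_corner_spiked:
  assumes d: "0 < d" and t: "1 \<le> t"
  shows "L1_norm (\<lambda>x. low_corner d s x * spiked J d t x) (\<lambda>x. indicator (corner d) x / spiked J d t (x :: real^'n))
    = ennreal (d ^ CARD('n))"
proof -
  have v0: "0 < spiked J d t x" for x :: "real^'n"
    by (rule spiked_pos[OF t])
  have "ennreal (\<bar>indicator (corner d) x / spiked J d t x\<bar> * (low_corner d s x * spiked J d t x)) = indicator (corner d) x"
    for x :: "real^'n"
    using v0[of x] by (auto simp: indicator_def low_corner_def)
  then have "L1_norm (\<lambda>x. low_corner d s x * spiked J d t x) (\<lambda>x. indicator (corner d) x / spiked J d t (x :: real^'n))
    = (\<integral>\<^sup>+x. indicator (corner d) (x :: real^'n) \<partial>lebesgue)"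
    unfolding L1_norm_def by simp
  also have "\<dots> = ennreal (d ^ CARD('n))"
    using d by (simp add: fmeasurableD[OF corner_lmeasurable] emeasure_eq_measure2[OF corner_lmeasurable] measure_corner)
  finally show ?thesis .
qed

section \<open>Choice of the parameters and conclusion\<close>

text \<open>Both constants are prescribed exactly, since the function in the theorem is arbitrary
  and its value at one pair says nothing about nearby pairs.\<close>

lemma A1_extremal_pair:
  fixes s t :: real
  assumes s: "1 \<le> s" and t: "1 \<le> t"
  obtains u v f :: "real^'n \<Rightarrow> real" and D :: real where "u \<in> A1" "v \<in> A1"
    "A1_const u = ennreal s" "A1_const v = ennreal t"
    "f \<in> L1 (\<lambda>x. u x * v x)" "0 < D" "L1_norm (\<lambda>x. u x * v x) f = ennreal D"
    "ennreal (s * t / (24 * 8 ^ CARD('n)) * D)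
      \<le> weak_L1_norm (\<lambda>x. u x * v x) (\<lambda>x. dyadic_maximal (\<lambda>y. f y * v y) x / ennreal (v x))"
proof -
  \<comment> \<open>With \<open>d = 1 / 2 ^ (p + 1)\<close> this gives
    \<open>(t - 1) * d \<le> 1\<close>, which bounds the mass of the spike.\<close>
  obtain p where p: "t < 2 ^ p" using real_arch_pow[of 2 t] by auto
  define d :: real where "d = 1 / 2 ^ Suc p"
  have d: "0 < d" "d \<le> 1/2"
    by (auto simp: d_def divide_simps)
  have td: "(t - 1) * d ^ CARD('n) \<le> 1"
  proof -
    have "d ^ CARD('n) \<le> d ^ 1"
      using d by (intro power_decreasing) (auto simp: Suc_le_eq)
    then have "(t - 1) * d ^ CARD('n) \<le> (t - 1) * d"
      using t by (intro mult_left_mono) auto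
    also have "\<dots> \<le> 1"
      using p t by (simp add: d_def divide_simps)
    finally show ?thesis .
  qed
  \<comment> \<open>The largest \<open>J\<close> with \<open>1 + 8 ^ N * (J + 1) \<le> t\<close>, if
    there is one; for smaller \<open>t\<close> the conversion to naturals and the truncated
    subtraction yield 0.\<close>
  define J where "J = nat \<lfloor>(t - 1) / 8 ^ CARD('n)\<rfloor> - 1"
  have J: "J = 0 \<or> 1 + 8 ^ CARD('n) * real (J + 1) \<le> t"
  proof (cases "J = 0")
    case False
    then have "real (J + 1) \<le> (t - 1) / 8 ^ CARD('n)"
      unfolding J_def by (simp add: of_nat_diff) linarith
    then show ?thesis by (simp add: field_simps)
  qed simp
  have "(t - 1) / 8 ^ CARD('n) < real (J + 2)"
    unfolding J_def by linarith
  then have "t < 1 + 8 ^ CARD('n) * real (J + 2)"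
    by (simp add: field_simps)
  \<comment> \<open>The factor 3 collects \<open>1 \<le> 8 ^ N * (J + 1)\<close> and
    \<open>J + 2 \<le> 2 * (J + 1)\<close>.\<close>
  also have "\<dots> \<le> 1 * (8 ^ CARD('n) * real (J + 1)) + 2 * (8 ^ CARD('n) * real (J + 1))"
  proof (rule add_mono)
    have "1 * 1 \<le> 8 ^ CARD('n) * real (J + 1)"
      by (intro mult_mono one_le_power) auto
    then show "1 \<le> 1 * (8 ^ CARD('n) * real (J + 1))" by simp
  qed (simp add: algebra_simps)
  finally have tJ: "t \<le> 3 * 8 ^ CARD('n) * real (J + 1)" by (simp add: mult_ac)
  define u :: "real^'n \<Rightarrow> real" where "u = low_corner d s"
  define v :: "real^'n \<Rightarrow> real" where "v = spiked J d t"
  define f :: "real^'n \<Rightarrow> real" where "f = (\<lambda>x. indicator (corner d) x / v x)"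
  have v0: "0 < v x" for x
    unfolding v_def by (rule spiked_pos[OF t])
  then have fv: "(\<lambda>y. f y * v y) = indicator (corner d)"
    by (auto simp: f_def fun_eq_iff less_imp_neq[symmetric])
  have norm: "L1_norm (\<lambda>x. u x * v x) f = ennreal (d ^ CARD('n))"
    unfolding u_def f_def v_def by (rule L1_norm_low_corner_spiked[OF d(1) t])
  define D where "D = d ^ CARD('n)"
  \<comment> \<open>24 is the product of 3 from \<open>tJ\<close>, 4 from the level
    \<open>D / 4\<close> at which the weak norm is tested, and 2 from the half contributed by each
    layer.\<close>
  have "s * t / (24 * 8 ^ CARD('n)) * D \<le> s * (3 * 8 ^ CARD('n) * real (J + 1)) / (24 * 8 ^ CARD('n)) * D"
    using tJ s d unfolding D_def by (intro mult_right_mono divide_right_mono mult_left_mono) auto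
  also have "\<dots> = D / 4 * (s * (real (J + 1) / 2))"
    by (simp add: field_simps)
  finally have "ennreal (s * t / (24 * 8 ^ CARD('n)) * D) \<le> ennreal (D / 4) * ennreal (s * (real (J + 1) / 2))"
    using s d by (subst ennreal_mult[symmetric]) (auto simp: D_def intro!: ennreal_leI)
  also have "\<dots> \<le> ennreal (D / 4) * wmeasure (\<lambda>x. u x * v x)
      {x. ennreal (D / 4) < dyadic_maximal (indicator (corner d)) x / ennreal (v x)}"
  proof (rule mult_left_mono)
    have "ennreal (s * (real (J + 1) / 2)) \<le> wmeasure (\<lambda>x. u x * v x) (corner (2 ^ J) - corner d)"
      unfolding u_def v_def by (rule wmeasure_corner_diff_ge[OF d s t])
    also have "\<dots> \<le> wmeasure (\<lambda>x. u x * v x)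
        {x. ennreal (D / 4) < dyadic_maximal (indicator (corner d)) x / ennreal (v x)}"
      unfolding wmeasure_def using dyadic_maximal_over_spiked_gt[OF d t]
      by (intro nn_integral_mono) (auto simp: indicator_def D_def v_def)
    finally show "ennreal (s * (real (J + 1) / 2)) \<le> wmeasure (\<lambda>x. u x * v x)
        {x. ennreal (D / 4) < dyadic_maximal (indicator (corner d)) x / ennreal (v x)}" .
  qed simp
  also have "\<dots> \<le> weak_L1_norm (\<lambda>x. u x * v x) (\<lambda>x. dyadic_maximal (indicator (corner d)) x / ennreal (v x))"
    unfolding weak_L1_norm_def using d by (intro SUP_upper) (simp add: D_def)
  finally have weak: "ennreal (s * t / (24 * 8 ^ CARD('n)) * D)
      \<le> weak_L1_norm (\<lambda>x. u x * v x) (\<lambda>x. dyadic_maximal (\<lambda>y. f y * v y) x / ennreal (v x))"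
    unfolding fv .
  have "f \<in> L1 (\<lambda>x. u x * v x)"
    unfolding L1_def using norm spiked_measurable[of J d t, where 'n = 'n]
    by (auto simp: f_def v_def intro!: borel_measurable_divide borel_measurable_indicator fmeasurableD[OF corner_lmeasurable])
  moreover have "A1_const v = ennreal t"
    unfolding v_def by (intro antisym A1_const_spiked_le A1_const_spiked_ge d t td J)
  ultimately show thesis
    using weak norm d that[of u v f D]
    by (simp add: D_def u_def v_def low_corner_A1[OF d(1) s] A1_const_low_corner[OF d(1) s] spiked_A1[OF d t td J])
qed

theorem theorem1p11:
  fixes \<phi> :: "real \<Rightarrow> real \<Rightarrow> real" and c :: real
  assumes "\<And>s t. 1 \<le> s \<Longrightarrow> 1 \<le> t \<Longrightarrow> 0 < \<phi> s t"
    and "0 < c"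
    and "\<And>(u :: real^'n \<Rightarrow> real) v f. u \<in> A1 \<Longrightarrow> v \<in> A1 \<Longrightarrow> f \<in> L1 (\<lambda>x. u x * v x) \<Longrightarrow>
      weak_L1_norm (\<lambda>x. u x * v x) (\<lambda>x. dyadic_maximal (\<lambda>y. f y * v y) x / ennreal (v x))
        \<le> ennreal (c * \<phi> (enn2real (A1_const u)) (enn2real (A1_const v)))
            * L1_norm (\<lambda>x. u x * v x) f"
  shows "\<exists>c'>0. \<forall>(u :: real^'n \<Rightarrow> real)\<in>A1. \<forall>(v :: real^'n \<Rightarrow> real)\<in>A1.
    c' * enn2real (A1_const u) * enn2real (A1_const v)
      \<le> \<phi> (enn2real (A1_const u)) (enn2real (A1_const v))"
proof (intro exI conjI ballI)
  show "0 < 1 / (24 * 8 ^ CARD('n) * c)" using \<open>0 < c\<close> by simp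
  \<comment> \<open>The given weights enter only through their constants; the hypothesis is applied
    to the extremal pair with the same constants.\<close>
  fix u0 v0 :: "real^'n \<Rightarrow> real" assume A1: "u0 \<in> A1" "v0 \<in> A1"
  define s where "s = enn2real (A1_const u0)"
  define t where "t = enn2real (A1_const v0)"
  have ge1: "1 \<le> enn2real (A1_const w)" if "w \<in> A1" for w :: "real^'n \<Rightarrow> real"
    using enn2real_mono[OF A1_const_ge_1[OF that]] that by (simp add: A1_def)
  have s: "1 \<le> s" and t: "1 \<le> t"
    unfolding s_def t_def by (intro ge1 A1)+
  obtain u v f :: "real^'n \<Rightarrow> real" and D :: real where uv: "u \<in> A1" "v \<in> A1"
    "A1_const u = ennreal s" "A1_const v = ennreal t"
    "f \<in> L1 (\<lambda>x. u x * v x)" "0 < D" "L1_norm (\<lambda>x. u x * v x) f = ennreal D"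
    "ennreal (s * t / (24 * 8 ^ CARD('n)) * D)
      \<le> weak_L1_norm (\<lambda>x. u x * v x) (\<lambda>x. dyadic_maximal (\<lambda>y. f y * v y) x / ennreal (v x))"
    using A1_extremal_pair[OF s t] .
  have pos: "0 < c * \<phi> s t" using assms(1)[OF s t] \<open>0 < c\<close> by simp
  have "ennreal (s * t / (24 * 8 ^ CARD('n)) * D) \<le> ennreal (c * \<phi> s t) * ennreal D"
    using uv(8) assms(3)[OF uv(1,2,5)] s t by (simp add: uv(3,4,7) order_trans)
  also have "\<dots> = ennreal (c * \<phi> s t * D)"
    using pos uv(6) by (intro ennreal_mult[symmetric]) auto
  finally have "s * t / (24 * 8 ^ CARD('n)) * D \<le> c * \<phi> s t * D"
    using pos uv(6) by (subst (asm) ennreal_le_iff) auto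
  \<comment> \<open>The norm \<open>D\<close> cancels, so the bound does not see the size of the
    corner, which depends on \<open>t\<close>.\<close>
  then have "s * t / (24 * 8 ^ CARD('n)) \<le> c * \<phi> s t"
    using uv(6) by (simp only: mult_le_cancel_right_pos)
  then have "1 / (24 * 8 ^ CARD('n) * c) * s * t \<le> \<phi> s t"
    using \<open>0 < c\<close> by (simp add: field_simps)
  then show "1 / (24 * 8 ^ CARD('n) * c) * enn2real (A1_const u0) * enn2real (A1_const v0)
      \<le> \<phi> (enn2real (A1_const u0)) (enn2real (A1_const v0))"
    unfolding s_def t_def .
qed

end
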